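(* There is a linear-time algorithm that, given a diagonal grid graph $G_{p,q}$, computes a bar 1-visibility drawing of $G_{p,q}$. In particular, every diagonal grid graph is bar 1-visible.
   Context: A $p\times q$-grid graph has as vertices the grid points of a $p\times q$ grid in the plane ($p$ rows, $q$ columns; vertex $v_{ij}$ lies on the $i$th row and $j$th column, $1\le i\le p$, $1\le j\le q$), and as edges the grid-line segments joining consecutive grid points in a row or column. A diagonal grid graph $G_{p,q}$ is a $p\times q$-grid graph in which both diagonal edges are added in every unit cell: if a cell has bottom-left vertex $a$, bottom-right $b$, upper-right $c$ and upper-left $d$, the edges $(a,c)$ and $(b,d)$ are added. A bar 1-visibility drawing of a graph $G$ draws each vertex as a horizontal line segment (a bar), pairwise disjoint, and each edge $(u,v)$ as a vertical line segment whose two endpoints lie on the bars of $u$ and $v$, such that the vertical segment of each edge intersects at most one bar other than the bars of its two end vertices. A graph is bar 1-visible if it has a bar 1-visibility drawing. Linear time means time linear in the size (number of vertices) of the graph. *)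

theory Defs
  imports "HOL-Analysis.Analysis"
begin

section \<open>Diagonal grid graphs\<close>

text \<open>A simple graph is a pair of its vertex set and its set of two-element edge sets.\<close>

type_synonym 'v graph = "'v set \<times> 'v set set"

abbreviation verts :: "'v graph \<Rightarrow> 'v set" where "verts \<equiv> fst"
abbreviation edges :: "'v graph \<Rightarrow> 'v set set" where "edges \<equiv> snd"

text \<open>The vertex \<open>(i, j)\<close> is the grid point in row \<open>i\<close> and column \<open>j\<close>.\<close>

definition grid_verts :: "nat \<Rightarrow> nat \<Rightarrow> (nat \<times> nat) set" where
  "grid_verts p q = {1..p} \<times> {1..q}"

definition grid_edges :: "nat \<Rightarrow> nat \<Rightarrow> (nat \<times> nat) set set" where
  "grid_edges p q =
     {{(i, j), (i, j + 1)} | i j. 1 \<le> i \<and> i \<le> p \<and> 1 \<le> j \<and> j + 1 \<le> q} \<union>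
     {{(i, j), (i + 1, j)} | i j. 1 \<le> i \<and> i + 1 \<le> p \<and> 1 \<le> j \<and> j \<le> q}"

definition diagonal_edges :: "nat \<Rightarrow> nat \<Rightarrow> (nat \<times> nat) set set" where
  "diagonal_edges p q =
     {{(i, j), (i + 1, j + 1)} | i j. 1 \<le> i \<and> i + 1 \<le> p \<and> 1 \<le> j \<and> j + 1 \<le> q} \<union>
     {{(i, j + 1), (i + 1, j)} | i j. 1 \<le> i \<and> i + 1 \<le> p \<and> 1 \<le> j \<and> j + 1 \<le> q}"

definition diagonal_grid_graph :: "nat \<Rightarrow> nat \<Rightarrow> (nat \<times> nat) graph" where
  "diagonal_grid_graph p q = (grid_verts p q, grid_edges p q \<union> diagonal_edges p q)"


section \<open>Bar 1-visibility drawings\<close>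

text \<open>
  \<open>B v\<close> is the bar drawn for the vertex \<open>v\<close>, and \<open>S e\<close> the segment drawn for the edge \<open>e\<close>.
  Bars are closed and nondegenerate.  Segments of different edges may meet, and bars of
  nonadjacent vertices may see each other.
\<close>

definition horizontal_segment :: "(real \<times> real) set \<Rightarrow> bool" where
  "horizontal_segment A \<longleftrightarrow> (\<exists>l r y. l < r \<and> A = closed_segment (l, y) (r, y))"

definition bar_1_visibility_drawing ::
    "'v graph \<Rightarrow> ('v \<Rightarrow> (real \<times> real) set) \<Rightarrow> ('v set \<Rightarrow> (real \<times> real) set) \<Rightarrow> bool" where
  "bar_1_visibility_drawing G B S \<longleftrightarrow>
     (\<forall>v\<in>verts G. horizontal_segment (B v)) \<and>
     disjoint_family_on B (verts G) \<and>
     (\<forall>u v. {u, v} \<in> edges G \<longrightarrow>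
        (\<exists>x y y'. S {u, v} = closed_segment (x, y) (x, y') \<and> (x, y) \<in> B u \<and> (x, y') \<in> B v) \<and>
        (\<forall>w\<in>verts G - {u, v}. \<forall>w'\<in>verts G - {u, v}.
           S {u, v} \<inter> B w \<noteq> {} \<longrightarrow> S {u, v} \<inter> B w' \<noteq> {} \<longrightarrow> w = w'))"

definition bar_1_visible :: "'v graph \<Rightarrow> bool" where
  "bar_1_visible G \<longleftrightarrow> (\<exists>B S. bar_1_visibility_drawing G B S)"


section \<open>Random access machine\<close>

text \<open>
  Programs of a random access machine with finitely many registers per program, an
  addressable memory and a write-only output tape.  Every operation costs one time unit.
  To keep the uniform cost measure honest, execution is relative to a bound \<open>W\<close> on all
  numbers, addresses included: an instruction that computes a larger number is stuck.
\<close>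

datatype expr =
    Const nat
  | Reg nat
  | Load expr
  | Plus expr expr
  | Minus expr expr
  | Times expr expr
  | Div expr expr
  | Mod expr expr

datatype com =
    Skip
  | Assign nat expr
  | Store expr expr
  | Emit expr
  | Seq com com
  | If expr com com
  | While expr com

record state =
  regs :: "nat \<Rightarrow> nat"
  mem :: "nat \<Rightarrow> nat"
  tape :: "nat list"

text \<open>Subtraction is truncated at zero.\<close>

primrec eval :: "state \<Rightarrow> expr \<Rightarrow> nat" where
  "eval s (Const k) = k"
| "eval s (Reg r) = regs s r"
| "eval s (Load e) = mem s (eval s e)"
| "eval s (Plus e f) = eval s e + eval s f"
| "eval s (Minus e f) = eval s e - eval s f"
| "eval s (Times e f) = eval s e * eval s f"
| "eval s (Div e f) = eval s e div eval s f"
| "eval s (Mod e f) = eval s e mod eval s f"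

primrec expr_cost :: "expr \<Rightarrow> nat" where
  "expr_cost (Const k) = 1"
| "expr_cost (Reg r) = 1"
| "expr_cost (Load e) = expr_cost e + 1"
| "expr_cost (Plus e f) = expr_cost e + expr_cost f + 1"
| "expr_cost (Minus e f) = expr_cost e + expr_cost f + 1"
| "expr_cost (Times e f) = expr_cost e + expr_cost f + 1"
| "expr_cost (Div e f) = expr_cost e + expr_cost f + 1"
| "expr_cost (Mod e f) = expr_cost e + expr_cost f + 1"

text \<open>All numbers arising in the evaluation of an expression are at most \<open>W\<close>.\<close>

primrec fits :: "nat \<Rightarrow> state \<Rightarrow> expr \<Rightarrow> bool" where
  "fits W s (Const k) \<longleftrightarrow> k \<le> W"
| "fits W s (Reg r) \<longleftrightarrow> regs s r \<le> W"
| "fits W s (Load e) \<longleftrightarrow> fits W s e \<and> eval s (Load e) \<le> W"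
| "fits W s (Plus e f) \<longleftrightarrow> fits W s e \<and> fits W s f \<and> eval s (Plus e f) \<le> W"
| "fits W s (Minus e f) \<longleftrightarrow> fits W s e \<and> fits W s f \<and> eval s (Minus e f) \<le> W"
| "fits W s (Times e f) \<longleftrightarrow> fits W s e \<and> fits W s f \<and> eval s (Times e f) \<le> W"
| "fits W s (Div e f) \<longleftrightarrow> fits W s e \<and> fits W s f \<and> eval s (Div e f) \<le> W"
| "fits W s (Mod e f) \<longleftrightarrow> fits W s e \<and> fits W s f \<and> eval s (Mod e f) \<le> W"

text \<open>
  \<open>exec W c s t s'\<close>: the program \<open>c\<close> started in \<open>s\<close> halts in \<open>s'\<close> after \<open>t\<close> time units,
  with all numbers at most \<open>W\<close>.  Conditions hold when their value is nonzero.
\<close>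

inductive exec :: "nat \<Rightarrow> com \<Rightarrow> state \<Rightarrow> nat \<Rightarrow> state \<Rightarrow> bool" for W where
  Skip: "exec W Skip s 1 s"
| Assign: "fits W s e \<Longrightarrow>
    exec W (Assign r e) s (expr_cost e + 1) (s\<lparr>regs := (regs s)(r := eval s e)\<rparr>)"
| Store: "fits W s a \<Longrightarrow> fits W s e \<Longrightarrow>
    exec W (Store a e) s (expr_cost a + expr_cost e + 1) (s\<lparr>mem := (mem s)(eval s a := eval s e)\<rparr>)"
| Emit: "fits W s e \<Longrightarrow>
    exec W (Emit e) s (expr_cost e + 1) (s\<lparr>tape := tape s @ [eval s e]\<rparr>)"
| Seq: "exec W c s t s' \<Longrightarrow> exec W c' s' t' s'' \<Longrightarrow> exec W (Seq c c') s (t + t') s''"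
| IfTrue: "fits W s e \<Longrightarrow> eval s e \<noteq> 0 \<Longrightarrow> exec W c s t s' \<Longrightarrow>
    exec W (If e c c') s (expr_cost e + t + 1) s'"
| IfFalse: "fits W s e \<Longrightarrow> eval s e = 0 \<Longrightarrow> exec W c' s t s' \<Longrightarrow>
    exec W (If e c c') s (expr_cost e + t + 1) s'"
| WhileTrue: "fits W s e \<Longrightarrow> eval s e \<noteq> 0 \<Longrightarrow> exec W c s t s' \<Longrightarrow>
    exec W (While e c) s' t' s'' \<Longrightarrow>
    exec W (While e c) s (expr_cost e + t + t' + 1) s''"
| WhileFalse: "fits W s e \<Longrightarrow> eval s e = 0 \<Longrightarrow>
    exec W (While e c) s (expr_cost e + 1) s"

inductive_cases SkipE: "exec W Skip s t s'"
  and AssignE: "exec W (Assign r e) s t s'"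
  and StoreE: "exec W (Store a e) s t s'"
  and EmitE: "exec W (Emit e) s t s'"
  and SeqE: "exec W (Seq c c') s t s'"
  and IfE: "exec W (If e c c') s t s'"
  and WhileE: "exec W (While e c) s t s'"

lemma exec_deterministic:
  "exec W c s t s' \<Longrightarrow> exec W c s u s'' \<Longrightarrow> u = t \<and> s'' = s'"
proof (induction arbitrary: u s'' rule: exec.induct)
  case (Skip s) then show ?case by (auto elim: SkipE)
next
  case (Assign s e r) then show ?case by (auto elim: AssignE)
next
  case (Store s a e) then show ?case by (auto elim: StoreE)
next
  case (Emit s e) then show ?case by (auto elim: EmitE)
next
  case (Seq c s t s' c' t' s3)
  from Seq.prems obtain t1 s1 t2 where
    "u = t1 + t2" and 1: "exec W c s t1 s1" and 2: "exec W c' s1 t2 s''"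
    by (rule SeqE)
  moreover have "t1 = t \<and> s1 = s'" using Seq.IH(1)[OF 1] .
  ultimately show ?case using Seq.IH(2)[of t2 s''] by simp
next
  case (IfTrue s e c t s' c')
  from IfTrue.prems \<open>eval s e \<noteq> 0\<close> obtain t1 where
    "u = expr_cost e + t1 + 1" and 1: "exec W c s t1 s''"
    by (elim IfE) simp_all
  then show ?case using IfTrue.IH[OF 1] by simp
next
  case (IfFalse s e c' t s' c)
  from IfFalse.prems \<open>eval s e = 0\<close> obtain t1 where
    "u = expr_cost e + t1 + 1" and 1: "exec W c' s t1 s''"
    by (elim IfE) simp_all
  then show ?case using IfFalse.IH[OF 1] by simp
next
  case (WhileTrue s e c t s' t' s3)
  from WhileTrue.prems show ?case
  proof (rule WhileE)
    fix t1 s1 t2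
    assume u: "u = Suc (expr_cost e + t1 + t2)"
      and 1: "exec W c s t1 s1" and 2: "exec W (While e c) s1 t2 s''"
    have "t1 = t \<and> s1 = s'" using WhileTrue.IH(1)[OF 1] .
    then show ?case using u 2 WhileTrue.IH(2)[of t2 s''] by simp
  next
    assume "eval s e = 0"
    with \<open>eval s e \<noteq> 0\<close> show ?case by simp
  qed
next
  case (WhileFalse s e c)
  from WhileFalse.prems show ?case
    by (rule WhileE) (simp_all add: \<open>eval s e = 0\<close>)
qed

text \<open>The input word is placed at the start of the memory, everything else is zero.\<close>

definition initial_state :: "nat list \<Rightarrow> state" where
  "initial_state xs =
     \<lparr>regs = (\<lambda>_. 0), mem = (\<lambda>a. if a < length xs then xs ! a else 0), tape = []\<rparr>"

definition runs :: "nat \<Rightarrow> com \<Rightarrow> nat list \<Rightarrow> nat \<Rightarrow> nat list \<Rightarrow> bool" where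
  "runs W c xs t ys \<longleftrightarrow> (\<exists>s. exec W c (initial_state xs) t s \<and> tape s = ys)"


section \<open>Input and output formats\<close>

text \<open>
  A graph on grid points is given by a list of its vertices and a list of its edges, both
  without repetition and in arbitrary order; an edge is a pair of positions in the vertex
  list, in either orientation.
\<close>

definition represents :: "'v list \<Rightarrow> (nat \<times> nat) list \<Rightarrow> 'v graph \<Rightarrow> bool" where
  "represents vs es G \<longleftrightarrow>
     distinct vs \<and> set vs = verts G \<and>
     (\<forall>(a, b)\<in>set es. a < length vs \<and> b < length vs) \<and>
     distinct (map (\<lambda>(a, b). {vs ! a, vs ! b}) es) \<and>
     set (map (\<lambda>(a, b). {vs ! a, vs ! b}) es) = edges G"

definition input_word :: "(nat \<times> nat) list \<Rightarrow> (nat \<times> nat) list \<Rightarrow> nat list" where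
  "input_word vs es =
     [length vs, length es] @
     concat (map (\<lambda>(i, j). [i, j]) vs) @
     concat (map (\<lambda>(a, b). [a, b]) es)"

text \<open>
  The output lists, in the order of the input, left end, right end and height of every bar,
  followed by abscissa and the two end heights of the segment of every edge.
\<close>

definition output_describes ::
    "nat list \<Rightarrow> 'v list \<Rightarrow> (nat \<times> nat) list \<Rightarrow>
     ('v \<Rightarrow> (real \<times> real) set) \<Rightarrow> ('v set \<Rightarrow> (real \<times> real) set) \<Rightarrow> bool" where
  "output_describes ys vs es B S \<longleftrightarrow>
     (\<exists>bs ss. length bs = length vs \<and> length ss = length es \<and>
        ys = concat (map (\<lambda>(l, r, h). [l, r, h]) bs) @
             concat (map (\<lambda>(x, h, h'). [x, h, h']) ss) \<and>
        (\<forall>k<length vs. case bs ! k of (l, r, h) \<Rightarrow>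
           B (vs ! k) = closed_segment (real l, real h) (real r, real h)) \<and>
        (\<forall>k<length es. case (es ! k, ss ! k) of ((a, b), (x, h, h')) \<Rightarrow>
           S {vs ! a, vs ! b} = closed_segment (real x, real h) (real x, real h')))"

end

theory Submission imports Defs begin

text \<open>
  Turn the grid by 45 degrees.  With \<open>n \<ge> p\<close>, the bar of \<open>(i, j)\<close> is centred at
  abscissa \<open>2 * (n + j - i)\<close>, has length 4, and lies at height \<open>(i + j) * n + i\<close>, so that heights
  are ordered lexicographically by \<open>(i + j, i)\<close>.  Bars of one level \<open>i + j\<close> then overlap only in
  end abscissas, where the antidiagonal edges are drawn.  Row and column edges join
  consecutive levels at odd abscissas, where every level has at most one bar.  The edge from
  \<open>(i, j)\<close> to \<open>(i + 1, j + 1)\<close> is drawn at an odd abscissa too, so the only bar it crosses is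
  that of \<open>(i + 1, j)\<close>.  Each bar and each segment depends only on \<open>n\<close> and on the coordinates of
  its vertices, so two scans of the input produce the drawing; and there are at most four
  times as many edges as vertices.
\<close>

section \<open>The drawing\<close>

lemma mem_closed_segment_horizontal:
  fixes l r y :: real
  assumes "l \<le> r"
  shows "(a, b) \<in> closed_segment (l, y) (r, y) \<longleftrightarrow> b = y \<and> l \<le> a \<and> a \<le> r"
proof -
  have "closed_segment (l, y) (r, y) = (\<lambda>x. (x, y)) ` closed_segment l r"
    by (force simp: closed_segment_def algebra_simps)
  then show ?thesis using assms by (auto simp: closed_segment_eq_real_ivl)
qed

lemma mem_closed_segment_vertical:
  fixes x y z :: real
  shows "(a, b) \<in> closed_segment (x, y) (x, z) \<longleftrightarrow> a = x \<and> min y z \<le> b \<and> b \<le> max y z"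
proof -
  have "closed_segment (x, y) (x, z) = Pair x ` closed_segment y z"
    by (force simp: closed_segment_def algebra_simps)
  then show ?thesis by (auto simp: closed_segment_eq_real_ivl)
qed

section \<open>Bars, edge segments and where they meet\<close>

fun centre :: "nat \<Rightarrow> nat \<times> nat \<Rightarrow> nat" where
  "centre n (i, j) = n + j - i"

fun height :: "nat \<Rightarrow> nat \<times> nat \<Rightarrow> nat" where
  "height n (i, j) = i + (i + j) * n"

text \<open>By truncation, the subtrahend is 1 if the centres agree and 0 otherwise.\<close>

definition abscissa :: "nat \<Rightarrow> nat \<times> nat \<Rightarrow> nat \<times> nat \<Rightarrow> nat" where
  "abscissa n u v = centre n u + centre n v -
     (1 - ((centre n u - centre n v) + (centre n v - centre n u)))"

text \<open>For a vertex with row at most \<open>n\<close> and positive column the centre is at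
  least 1, so the left end is not truncated. Elsewhere truncation may shorten a bar, but it stays
  nondegenerate.\<close>

definition bar :: "nat \<Rightarrow> nat \<times> nat \<Rightarrow> (real \<times> real) set" where
  "bar n v = closed_segment (real (2 * centre n v - 2), real (height n v))
     (real (2 * centre n v + 2), real (height n v))"

definition joint :: "nat \<Rightarrow> nat \<times> nat \<Rightarrow> nat \<times> nat \<Rightarrow> (real \<times> real) set" where
  "joint n u v = closed_segment (real (abscissa n u v), real (height n u))
     (real (abscissa n u v), real (height n v))"

text \<open>A drawing assigns segments to unordered edges, whereas \<open>joint\<close> takes an
  ordered pair. The union over both orderings avoids choosing one; by symmetry of
  \<open>joint\<close> it is a single segment.\<close>

definition edge_segment :: "nat \<Rightarrow> (nat \<times> nat) set \<Rightarrow> (real \<times> real) set" where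
  "edge_segment n e = \<Union>{joint n u v | u v. {u, v} = e}"

lemma abscissa_commute: "abscissa n u v = abscissa n v u"
  by (simp add: abscissa_def add.commute)

lemma joint_commute: "joint n u v = joint n v u"
  by (simp add: joint_def abscissa_commute[of n u v] closed_segment_commute)

lemma edge_segment_doubleton: "edge_segment n {u, v} = joint n u v"
  unfolding edge_segment_def doubleton_eq_iff using joint_commute[of n u v] by blast

lemma mem_bar:
  "(x, y) \<in> bar n v \<longleftrightarrow>
     y = real (height n v) \<and> real (2 * centre n v - 2) \<le> x \<and> x \<le> real (2 * centre n v + 2)"
  unfolding bar_def by (intro mem_closed_segment_horizontal) simp

lemma mem_bar_nat:
  "(real x, real y) \<in> bar n v \<longleftrightarrow>
     y = height n v \<and> 2 * centre n v - 2 \<le> x \<and> x \<le> 2 * centre n v + 2"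
  unfolding mem_bar by linarith

text \<open>Passes from real geometry to inequalities between natural numbers, where integrality can
  be exploited.\<close>

lemma joint_meets_bar:
  assumes "joint n u v \<inter> bar n w \<noteq> {}"
  shows "2 * centre n w - 2 \<le> abscissa n u v" "abscissa n u v \<le> 2 * centre n w + 2"
    "min (height n u) (height n v) \<le> height n w" "height n w \<le> max (height n u) (height n v)"
proof -
  obtain x y where "(x, y) \<in> joint n u v" "(x, y) \<in> bar n w"
    using assms by auto
  then have "x = real (abscissa n u v)" "y = real (height n w)"
      "real (2 * centre n w - 2) \<le> x" "x \<le> real (2 * centre n w + 2)"
      "min (real (height n u)) (real (height n v)) \<le> y"
      "y \<le> max (real (height n u)) (real (height n v))"
    by (simp_all add: joint_def mem_closed_segment_vertical mem_bar)
  then show "2 * centre n w - 2 \<le> abscissa n u v" "abscissa n u v \<le> 2 * centre n w + 2"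
    "min (height n u) (height n v) \<le> height n w" "height n w \<le> max (height n u) (height n v)"
    by linarith+
qed

section \<open>Bars crossed by each of the four kinds of edges\<close>

text \<open>Consecutive levels are \<open>n\<close> apart in height, while rows between 1 and
  \<open>n\<close> differ by at most \<open>n - 1\<close>. So a higher level cannot be compensated
  by a smaller row.\<close>

lemma height_le_imp:
  assumes "height n (i, j) \<le> height n (a, b)" "1 \<le> i" "a \<le> n"
  shows "i + j < a + b \<or> i + j = a + b \<and> i \<le> a"
proof (cases "i + j \<le> a + b")
  case True
  then show ?thesis using assms(1) by (cases "i + j = a + b") simp_all
next
  case False
  then have "(a + b + 1) * n \<le> (i + j) * n" by (intro mult_right_mono) simp_all
  then show ?thesis using assms by (simp add: algebra_simps)
qed

text \<open>The heights leave only the levels \<open>i + j\<close> and \<open>i + j + 1\<close>.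
  Bars have half-width 2, so at abscissa \<open>2 * d + 1\<close> the centre \<open>c\<close> of a
  crossed bar is \<open>d\<close> or \<open>d + 1\<close>. Along a level, centres change in steps of
  2, which leaves one bar per level, and this is an end of the edge.\<close>

lemma row_edge_crossing:
  assumes meets: "joint n (i, j) (i, j + 1) \<inter> bar n w \<noteq> {}"
    and "1 \<le> i" "i \<le> n" "1 \<le> j" "w \<in> {1..n} \<times> {1..}"
  shows "w = (i, j) \<or> w = (i, j + 1)"
proof -
  obtain a b where w: "w = (a, b)" by (cases w)
  note m = joint_meets_bar[OF meets[unfolded w]]
  have ab: "1 \<le> a" "a \<le> n" "1 \<le> b"
    using assms by (simp_all add: w)
  have "height n (i, j) \<le> height n (i, j + 1)"
    by simp
  then have "height n (i, j) \<le> height n (a, b)" "height n (a, b) \<le> height n (i, j + 1)"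
    using m(3,4) by (simp_all only: min_absorb1 max_absorb2)
  note level = this[THEN height_le_imp]
  define c where "c = centre n (a, b)"
  define d where "d = centre n (i, j)"
  have centres: "c + a = n + b" "d + i = n + j" "1 \<le> d"
    using assms ab by (simp_all add: c_def d_def)
  have "abscissa n (i, j) (i, j + 1) = 2 * d + 1"
    using assms by (simp add: d_def abscissa_def)
  then have x: "2 * c \<le> 2 * d + 1 + 2" "2 * d + 1 \<le> 2 * c + 2"
    using m(1,2)[folded c_def] by simp_all
  consider "a + b = i + j" "i \<le> a" | "a + b = i + (j + 1)" "a \<le> i"
    using level assms(2,3) ab by fastforce
  then show ?thesis
  proof cases
    case 1
    then have "a = i" using centres x by linarith
    then show ?thesis using 1 w by simp
  next
    case 2
    then have "a = i" using centres x by linarith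
    then show ?thesis using 2 w by simp
  qed
qed

text \<open>As for row edges, but the centre decreases by 1 along the edge, so the abscissa is
  \<open>2 * d - 1\<close> and \<open>c\<close> is \<open>d\<close> or \<open>d - 1\<close>.\<close>

lemma column_edge_crossing:
  assumes meets: "joint n (i, j) (i + 1, j) \<inter> bar n w \<noteq> {}"
    and "1 \<le> i" "i + 1 \<le> n" "1 \<le> j" "w \<in> {1..n} \<times> {1..}"
  shows "w = (i, j) \<or> w = (i + 1, j)"
proof -
  obtain a b where w: "w = (a, b)" by (cases w)
  note m = joint_meets_bar[OF meets[unfolded w]]
  have ab: "1 \<le> a" "a \<le> n" "1 \<le> b"
    using assms by (simp_all add: w)
  have "height n (i, j) \<le> height n (i + 1, j)"
    by simp
  then have "height n (i, j) \<le> height n (a, b)" "height n (a, b) \<le> height n (i + 1, j)"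
    using m(3,4) by (simp_all only: min_absorb1 max_absorb2)
  note level = this[THEN height_le_imp]
  define c where "c = centre n (a, b)"
  define d where "d = centre n (i, j)"
  have centres: "c + a = n + b" "d + i = n + j" "1 \<le> d"
    using assms ab by (simp_all add: c_def d_def)
  have "abscissa n (i, j) (i + 1, j) = 2 * d - 1"
    using assms by (simp add: d_def abscissa_def)
  then have x: "2 * c \<le> 2 * d - 1 + 2" "2 * d - 1 \<le> 2 * c + 2"
    using m(1,2)[folded c_def] by simp_all
  consider "a + b = i + j" "i \<le> a" | "a + b = i + (j + 1)" "a \<le> i + 1"
    using level assms(2,3) ab by fastforce
  then show ?thesis
  proof cases
    case 1
    then have "a = i" using centres x by linarith
    then show ?thesis using 1 w by simp
  next
    case 2
    then have "a = i + 1" using centres x by linarith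
    then show ?thesis using 2 w by simp
  qed
qed

text \<open>Both ends are on the same level and in consecutive rows, so no height of another vertex
  lies between theirs. The abscissa is irrelevant.\<close>

lemma antidiagonal_edge_crossing:
  assumes meets: "joint n (i, j + 1) (i + 1, j) \<inter> bar n w \<noteq> {}"
    and "1 \<le> i" "i + 1 \<le> n" "1 \<le> j" "w \<in> {1..n} \<times> {1..}"
  shows "w = (i, j + 1) \<or> w = (i + 1, j)"
proof -
  obtain a b where w: "w = (a, b)" by (cases w)
  note m = joint_meets_bar[OF meets[unfolded w]]
  have ab: "1 \<le> a" "a \<le> n" "1 \<le> b"
    using assms by (simp_all add: w)
  have le: "height n (i, j + 1) \<le> height n (i + 1, j)"
    by simp
  have *: "height n (i, j + 1) \<le> height n (a, b)" "height n (a, b) \<le> height n (i + 1, j)"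
    using m(3,4) le by (simp_all only: min_absorb1 max_absorb2)
  have "i + (j + 1) < a + b \<or> i + (j + 1) = a + b \<and> i \<le> a"
    "a + b < i + 1 + j \<or> a + b = i + 1 + j \<and> a \<le> i + 1"
    using *[THEN height_le_imp] assms(2,3) ab by simp_all
  then show ?thesis using w by force
qed

text \<open>Both ends have centre \<open>d\<close>. The even abscissa \<open>2 * d\<close> would
  touch the bars of both \<open>(i, j + 1)\<close> and \<open>(i + 1, j)\<close> on the middle
  level; the correction in \<open>abscissa\<close> shifts it to \<open>2 * d - 1\<close>, inside the
  second bar only.\<close>

lemma diagonal_edge_crossing:
  assumes meets: "joint n (i, j) (i + 1, j + 1) \<inter> bar n w \<noteq> {}"
    and "1 \<le> i" "i + 1 \<le> n" "1 \<le> j" "w \<in> {1..n} \<times> {1..}"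
  shows "w = (i, j) \<or> w = (i + 1, j + 1) \<or> w = (i + 1, j)"
proof -
  obtain a b where w: "w = (a, b)" by (cases w)
  note m = joint_meets_bar[OF meets[unfolded w]]
  have ab: "1 \<le> a" "a \<le> n" "1 \<le> b"
    using assms by (simp_all add: w)
  have "height n (i, j) \<le> height n (i + 1, j + 1)"
    by simp
  then have "height n (i, j) \<le> height n (a, b)" "height n (a, b) \<le> height n (i + 1, j + 1)"
    using m(3,4) by (simp_all only: min_absorb1 max_absorb2)
  note level = this[THEN height_le_imp]
  define c where "c = centre n (a, b)"
  define d where "d = centre n (i, j)"
  have centres: "c + a = n + b" "d + i = n + j" "1 \<le> d"
    using assms ab by (simp_all add: c_def d_def)
  have "abscissa n (i, j) (i + 1, j + 1) = 2 * d - 1"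
    using assms by (simp add: d_def abscissa_def)
  then have x: "2 * c \<le> 2 * d - 1 + 2" "2 * d - 1 \<le> 2 * c + 2"
    using m(1,2)[folded c_def] by simp_all
  \<comment> \<open>The edge spans three levels. On the outer two, parity forces
    \<open>c = d\<close>; on the middle one it forces \<open>c = d - 1\<close>.\<close>
  consider "a + b = i + j" "i \<le> a" | "a + b = i + j + 1" | "a + b = i + j + 2" "a \<le> i + 1"
    using level assms(2,3) ab by fastforce
  then show ?thesis
  proof cases
    case 1
    then have "a = i" using centres x by linarith
    then show ?thesis using 1 w by simp
  next
    case 2
    then have "a = i + 1" using centres x by linarith
    then show ?thesis using 2 w by simp
  next
    case 3
    then have "a = i + 1" using centres x by linarith
    then show ?thesis using 3 w by simp
  qed
qed

lemma height_inj:
  assumes "height n v = height n w" "v \<in> {1..n} \<times> A" "w \<in> {1..n} \<times> A"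
  shows "v = w"
proof -
  obtain i j where v: "v = (i, j)" by (cases v)
  obtain a b where w: "w = (a, b)" by (cases w)
  have "height n (i, j) \<le> height n (a, b)" "height n (a, b) \<le> height n (i, j)"
    using assms(1) by (simp_all only: v w order_refl)
  from this[THEN height_le_imp] show ?thesis using assms(2,3) by (auto simp: v w)
qed

section \<open>Assembling the drawing\<close>

text \<open>Lets a claim about arbitrary edges be checked for each kind in one fixed orientation;
  symmetry of \<open>P\<close> covers the reversed pair.\<close>

lemma diagonal_grid_edge_cases:
  assumes edge: "{u, v} \<in> edges (diagonal_grid_graph p q)"
    and sym: "\<And>u v. P u v \<Longrightarrow> P v u"
    and row: "\<And>i j. 1 \<le> i \<Longrightarrow> i \<le> p \<Longrightarrow> 1 \<le> j \<Longrightarrow> P (i, j) (i, j + 1)"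
    and column: "\<And>i j. 1 \<le> i \<Longrightarrow> i + 1 \<le> p \<Longrightarrow> 1 \<le> j \<Longrightarrow> P (i, j) (i + 1, j)"
    and diagonal: "\<And>i j. 1 \<le> i \<Longrightarrow> i + 1 \<le> p \<Longrightarrow> 1 \<le> j \<Longrightarrow> P (i, j) (i + 1, j + 1)"
    and antidiagonal: "\<And>i j. 1 \<le> i \<Longrightarrow> i + 1 \<le> p \<Longrightarrow> 1 \<le> j \<Longrightarrow> P (i, j + 1) (i + 1, j)"
  shows "P u v"
proof -
  have "\<exists>z w. {u, v} = {z, w} \<and> P z w"
    using edge
    unfolding diagonal_grid_graph_def grid_edges_def diagonal_edges_def snd_conv Un_iff
    by (elim disjE CollectE exE conjE)
      (rule exI, rule exI, rule conjI, assumption,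
        rule row column diagonal antidiagonal; assumption | linarith)+
  then show ?thesis using sym unfolding doubleton_eq_iff by blast
qed

text \<open>Expresses the four centres of a unit cell through the smallest one, that of
  \<open>(i + 1, j)\<close>, so that truncated subtraction disappears from later
  computations.\<close>

lemma centre_Suc:
  assumes "i + 1 \<le> n" "1 \<le> j"
  obtains d where "1 \<le> d" "centre n (i, j) = d + 1" "centre n (i, j + 1) = d + 2"
    "centre n (i + 1, j) = d" "centre n (i + 1, j + 1) = d + 1"
proof
  show "1 \<le> n + j - (i + 1)" using assms by simp
qed (use assms in simp_all)

lemma joint_endpoints:
  assumes "{u, v} \<in> edges (diagonal_grid_graph p q)" "p \<le> n"
  shows "(real (abscissa n u v), real (height n u)) \<in> bar n u \<and>
    (real (abscissa n u v), real (height n v)) \<in> bar n v"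
  using assms(1)
proof (rule diagonal_grid_edge_cases)
  fix u v
  assume "(real (abscissa n u v), real (height n u)) \<in> bar n u \<and>
    (real (abscissa n u v), real (height n v)) \<in> bar n v"
  then show "(real (abscissa n v u), real (height n v)) \<in> bar n v \<and>
    (real (abscissa n v u), real (height n u)) \<in> bar n u"
    by (simp add: abscissa_commute[of n v u])
next
  fix i j :: nat
  assume ij: "1 \<le> i" "1 \<le> j"
  show "(real (abscissa n (i, j) (i, j + 1)), real (height n (i, j))) \<in> bar n (i, j) \<and>
      (real (abscissa n (i, j) (i, j + 1)), real (height n (i, j + 1))) \<in> bar n (i, j + 1)"
    if "i \<le> p"
  proof -
    \<comment> \<open>A row edge may lie in row \<open>n\<close>, where \<open>centre_Suc\<close> is
      not applicable.\<close>
    have "centre n (i, j + 1) = centre n (i, j) + 1"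
      using ij that assms(2) by simp
    then show ?thesis unfolding mem_bar_nat abscissa_def by (simp del: centre.simps)
  qed
  assume i: "i + 1 \<le> p"
  then obtain d where d: "1 \<le> d" "centre n (i, j) = d + 1" "centre n (i, j + 1) = d + 2"
    "centre n (i + 1, j) = d" "centre n (i + 1, j + 1) = d + 1"
    using centre_Suc[of i n j] ij assms(2) by auto
  show "(real (abscissa n (i, j) (i + 1, j)), real (height n (i, j))) \<in> bar n (i, j) \<and>
      (real (abscissa n (i, j) (i + 1, j)), real (height n (i + 1, j))) \<in> bar n (i + 1, j)"
    using d(1) unfolding mem_bar_nat abscissa_def d(2-) by simp
  show "(real (abscissa n (i, j) (i + 1, j + 1)), real (height n (i, j))) \<in> bar n (i, j) \<and>
      (real (abscissa n (i, j) (i + 1, j + 1)), real (height n (i + 1, j + 1))) \<in> bar n (i + 1, j + 1)"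
    using d(1) unfolding mem_bar_nat abscissa_def d(2-) by simp
  show "(real (abscissa n (i, j + 1) (i + 1, j)), real (height n (i, j + 1))) \<in> bar n (i, j + 1) \<and>
      (real (abscissa n (i, j + 1) (i + 1, j)), real (height n (i + 1, j))) \<in> bar n (i + 1, j)"
    using d(1) unfolding mem_bar_nat abscissa_def d(2-) by simp
qed

text \<open>The witness \<open>z\<close> is \<open>(i + 1, j)\<close> for a diagonal edge from
  \<open>(i, j)\<close> to \<open>(i + 1, j + 1)\<close>; for the other kinds nothing but the ends
  is met and any \<open>z\<close> will do.\<close>

lemma at_most_one_crossing:
  assumes "{u, v} \<in> edges (diagonal_grid_graph p q)" "p \<le> n"
  shows "\<exists>z. \<forall>w\<in>grid_verts p q. joint n u v \<inter> bar n w \<noteq> {} \<longrightarrow> w = u \<or> w = v \<or> w = z"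
  using assms(1)
proof (rule diagonal_grid_edge_cases)
  fix u v
  assume "\<exists>z. \<forall>w\<in>grid_verts p q. joint n u v \<inter> bar n w \<noteq> {} \<longrightarrow> w = u \<or> w = v \<or> w = z"
  then show "\<exists>z. \<forall>w\<in>grid_verts p q. joint n v u \<inter> bar n w \<noteq> {} \<longrightarrow> w = v \<or> w = u \<or> w = z"
    unfolding joint_commute[of n v u] by blast
next
  fix i j :: nat
  assume ij: "1 \<le> i" "1 \<le> j"
  have w: "w \<in> {1..n} \<times> {1..}" if "w \<in> grid_verts p q" for w
    using that assms(2) by (auto simp: grid_verts_def)
  show "\<exists>z. \<forall>w\<in>grid_verts p q. joint n (i, j) (i, j + 1) \<inter> bar n w \<noteq> {} \<longrightarrow>
      w = (i, j) \<or> w = (i, j + 1) \<or> w = z" if "i \<le> p"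
    using row_edge_crossing[of n i j] ij order_trans[OF that assms(2)] w by blast
  assume i: "i + 1 \<le> p"
  have i': "i + 1 \<le> n" using i assms(2) by simp
  show "\<exists>z. \<forall>w\<in>grid_verts p q. joint n (i, j) (i + 1, j) \<inter> bar n w \<noteq> {} \<longrightarrow>
      w = (i, j) \<or> w = (i + 1, j) \<or> w = z"
    using column_edge_crossing[of n i j] ij i' w by blast
  show "\<exists>z. \<forall>w\<in>grid_verts p q. joint n (i, j) (i + 1, j + 1) \<inter> bar n w \<noteq> {} \<longrightarrow>
      w = (i, j) \<or> w = (i + 1, j + 1) \<or> w = z"
    using diagonal_edge_crossing[of n i j] ij i' w by blast
  show "\<exists>z. \<forall>w\<in>grid_verts p q. joint n (i, j + 1) (i + 1, j) \<inter> bar n w \<noteq> {} \<longrightarrow>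
      w = (i, j + 1) \<or> w = (i + 1, j) \<or> w = z"
    using antidiagonal_edge_crossing[of n i j] ij i' w by blast
qed

lemma drawing_diagonal_grid:
  assumes "p \<le> n"
  shows "bar_1_visibility_drawing (diagonal_grid_graph p q) (bar n) (edge_segment n)"
  unfolding bar_1_visibility_drawing_def
proof (intro conjI ballI allI impI)
  fix v
  show "horizontal_segment (bar n v)"
  proof (unfold horizontal_segment_def bar_def, intro exI conjI)
    show "real (2 * centre n v - 2) < real (2 * centre n v + 2)" by linarith
  qed (rule refl)
next
  show "disjoint_family_on (bar n) (verts (diagonal_grid_graph p q))"
    unfolding disjoint_family_on_def
  proof (intro ballI impI)
    fix v w
    assume "v \<in> verts (diagonal_grid_graph p q)" "w \<in> verts (diagonal_grid_graph p q)" "v \<noteq> w"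
    then have "height n v \<noteq> height n w"
      using height_inj[of n v w UNIV] assms by (auto simp: diagonal_grid_graph_def grid_verts_def)
    then show "bar n v \<inter> bar n w = {}"
      by (auto simp: mem_bar)
  qed
next
  fix u v
  assume e: "{u, v} \<in> edges (diagonal_grid_graph p q)"
  have "(real (abscissa n u v), real (height n u)) \<in> bar n u"
    "(real (abscissa n u v), real (height n v)) \<in> bar n v"
    using joint_endpoints[OF e assms] by simp_all
  then show "\<exists>x y y'. edge_segment n {u, v} = closed_segment (x, y) (x, y') \<and>
      (x, y) \<in> bar n u \<and> (x, y') \<in> bar n v"
    unfolding edge_segment_doubleton joint_def by blast
next
  fix u v w w'
  assume e: "{u, v} \<in> edges (diagonal_grid_graph p q)"
    and "w \<in> verts (diagonal_grid_graph p q) - {u, v}"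
    and "w' \<in> verts (diagonal_grid_graph p q) - {u, v}"
    and "edge_segment n {u, v} \<inter> bar n w \<noteq> {}" "edge_segment n {u, v} \<inter> bar n w' \<noteq> {}"
  then show "w = w'"
    using at_most_one_crossing[OF e assms]
    unfolding edge_segment_doubleton diagonal_grid_graph_def fst_conv by blast
qed

text \<open>Each of the four families is contained in the image of the vertex set under a map from
  the corner \<open>(i, j)\<close> to an edge. This turns a running time in vertices and edges into
  one in vertices alone.\<close>

lemma card_edges_diagonal_grid_le:
  "card (edges (diagonal_grid_graph p q)) \<le> 4 * card (verts (diagonal_grid_graph p q))"
proof -
  let ?V = "grid_verts p q"
  have card_le: "card A \<le> card ?V" if "A \<subseteq> f ` ?V" for A :: "(nat \<times> nat) set set" and f
  proof -
    have "finite ?V" by (simp add: grid_verts_def)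
    then show ?thesis using that by (meson card_image_le card_mono finite_imageI order_trans)
  qed
  have "card {{(i, j), (i, j + 1)} | i j. 1 \<le> i \<and> i \<le> p \<and> 1 \<le> j \<and> j + 1 \<le> q} \<le> card ?V"
    by (rule card_le[where f = "\<lambda>(i, j). {(i, j), (i, j + 1)}"]) (force simp: grid_verts_def)
  moreover have "card {{(i, j), (i + 1, j)} | i j. 1 \<le> i \<and> i + 1 \<le> p \<and> 1 \<le> j \<and> j \<le> q} \<le> card ?V"
    by (rule card_le[where f = "\<lambda>(i, j). {(i, j), (i + 1, j)}"]) (force simp: grid_verts_def)
  moreover have "card {{(i, j), (i + 1, j + 1)} | i j. 1 \<le> i \<and> i + 1 \<le> p \<and> 1 \<le> j \<and> j + 1 \<le> q} \<le> card ?V"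
    by (rule card_le[where f = "\<lambda>(i, j). {(i, j), (i + 1, j + 1)}"]) (force simp: grid_verts_def)
  moreover have "card {{(i, j + 1), (i + 1, j)} | i j. 1 \<le> i \<and> i + 1 \<le> p \<and> 1 \<le> j \<and> j + 1 \<le> q} \<le> card ?V"
    by (rule card_le[where f = "\<lambda>(i, j). {(i, j + 1), (i + 1, j)}"]) (force simp: grid_verts_def)
  moreover have "card ((A \<union> B) \<union> (C \<union> D)) \<le> 4 * n"
    if "card A \<le> n" "card B \<le> n" "card C \<le> n" "card D \<le> n" for A B C D :: "'b set" and n
    using that card_Un_le[of A B] card_Un_le[of C D] card_Un_le[of "A \<union> B" "C \<union> D"] by linarith
  ultimately show ?thesis
    unfolding diagonal_grid_graph_def grid_edges_def diagonal_edges_def fst_conv snd_conv by blast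
qed

section \<open>The program\<close>

text \<open>Register 0 is a pointer advancing by 2 and register 1 its end value; their truncated
  difference vanishes exactly at the end. Evaluating the guard costs 3 and the loop step 1, hence
  \<open>t + 4\<close> per round and 4 on exit.\<close>

lemma exec_scan:
  assumes body: "\<And>k s. k < N \<Longrightarrow> mem s = M \<Longrightarrow> regs s 0 = a + 2 * k \<Longrightarrow> regs s 1 = a + 2 * N \<Longrightarrow>
      \<exists>s'. exec W c s t s' \<and> mem s' = M \<and> regs s' 0 = a + 2 * (k + 1) \<and> regs s' 1 = a + 2 * N \<and>
        tape s' = tape s @ g k"
    and W: "a + 2 * N \<le> W"
    and "mem s = M" "regs s 0 = a + 2 * k" "regs s 1 = a + 2 * N" "k \<le> N"
  shows "\<exists>s'. exec W (While (Minus (Reg 1) (Reg 0)) c) s ((N - k) * (t + 4) + 4) s' \<and>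
    mem s' = M \<and> regs s' 0 = a + 2 * N \<and> tape s' = tape s @ concat (map g [k..<N])"
  using assms(3-)
proof (induction "N - k" arbitrary: k s)
  case 0
  have "exec W (While (Minus (Reg 1) (Reg 0)) c) s (expr_cost (Minus (Reg 1) (Reg 0)) + 1) s"
    using 0 W by (intro exec.WhileFalse) simp_all
  then show ?case using 0 by (intro exI[of _ s]) (simp add: eval_nat_numeral)
next
  case (Suc d)
  then have k: "k < N" and d: "d = N - (k + 1)" by simp_all
  obtain s' where s': "exec W c s t s'" "mem s' = M" "regs s' 0 = a + 2 * (k + 1)"
      "regs s' 1 = a + 2 * N" "tape s' = tape s @ g k"
    using body[OF k Suc.prems(1-3)] by blast
  obtain s'' where s'': "exec W (While (Minus (Reg 1) (Reg 0)) c) s' ((N - (k + 1)) * (t + 4) + 4) s''"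
      "mem s'' = M" "regs s'' 0 = a + 2 * N" "tape s'' = tape s' @ concat (map g [k + 1..<N])"
    using Suc.hyps(1)[OF d s'(2-4)] k by auto
  have "exec W (While (Minus (Reg 1) (Reg 0)) c) s
      (expr_cost (Minus (Reg 1) (Reg 0)) + t + ((N - (k + 1)) * (t + 4) + 4) + 1) s''"
    using Suc.prems k W by (intro exec.WhileTrue[OF _ _ s'(1) s''(1)]) simp_all
  moreover have "expr_cost (Minus (Reg 1) (Reg 0)) + t + ((N - (k + 1)) * (t + 4) + 4) + 1 =
      (N - k) * (t + 4) + 4"
    unfolding d[symmetric] Suc.hyps(2)[symmetric] by simp
  ultimately have "exec W (While (Minus (Reg 1) (Reg 0)) c) s ((N - k) * (t + 4) + 4) s''"
    by (simp only:)
  then show ?case using s'' s'(5) k by (intro exI[of _ s'']) (simp add: upt_conv_Cons)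
qed

text \<open>
  The argument \<open>a\<close> evaluates to the address of the row of a vertex; its column is stored in the
  next cell, and the number \<open>n\<close> of vertices in cell 0.
\<close>

definition centre_expr :: "expr \<Rightarrow> expr" where
  "centre_expr a = Minus (Plus (Load (Const 0)) (Load (Plus a (Const 1)))) (Load a)"

definition height_expr :: "expr \<Rightarrow> expr" where
  "height_expr a =
     Plus (Load a) (Times (Plus (Load a) (Load (Plus a (Const 1)))) (Load (Const 0)))"

definition abscissa_expr :: "expr \<Rightarrow> expr \<Rightarrow> expr" where
  "abscissa_expr a b = Minus (Plus (centre_expr a) (centre_expr b))
     (Minus (Const 1) (Plus (Minus (centre_expr a) (centre_expr b))
       (Minus (centre_expr b) (centre_expr a))))"

definition vertex_code :: com where
  "vertex_code =
     Seq (Emit (Minus (Times (Const 2) (centre_expr (Reg 0))) (Const 2)))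
    (Seq (Emit (Plus (Times (Const 2) (centre_expr (Reg 0))) (Const 2)))
    (Seq (Emit (height_expr (Reg 0)))
         (Assign 0 (Plus (Reg 0) (Const 2)))))"

text \<open>Cells 0 and 1 hold the two lengths, so the vertex at position \<open>a\<close> starts at
  address \<open>2 + 2 * a\<close>. Registers 2 and 3 receive these addresses for the two
  ends.\<close>

definition edge_code :: com where
  "edge_code =
     Seq (Assign 2 (Plus (Const 2) (Times (Const 2) (Load (Reg 0)))))
    (Seq (Assign 3 (Plus (Const 2) (Times (Const 2) (Load (Plus (Reg 0) (Const 1))))))
    (Seq (Emit (abscissa_expr (Reg 2) (Reg 3)))
    (Seq (Emit (height_expr (Reg 2)))
    (Seq (Emit (height_expr (Reg 3)))
         (Assign 0 (Plus (Reg 0) (Const 2)))))))"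

text \<open>After the first loop register 0 points just behind the vertex list, which is the first
  edge entry, so it is not reset.\<close>

definition drawing_code :: com where
  "drawing_code =
     Seq (Assign 0 (Const 2))
    (Seq (Assign 1 (Plus (Reg 0) (Times (Const 2) (Load (Const 0)))))
    (Seq (While (Minus (Reg 1) (Reg 0)) vertex_code)
    (Seq (Assign 1 (Plus (Reg 0) (Times (Const 2) (Load (Const 1)))))
         (While (Minus (Reg 1) (Reg 0)) edge_code))))"

section \<open>Values, word bounds and costs of the code\<close>

lemma eval_centre_expr:
  assumes "mem s 0 = n" "mem s (eval s a) = fst v" "mem s (eval s a + 1) = snd v"
  shows "eval s (centre_expr a) = centre n v"
  using assms by (cases v) (simp add: centre_expr_def)

lemma eval_height_expr:
  assumes "mem s 0 = n" "mem s (eval s a) = fst v" "mem s (eval s a + 1) = snd v"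
  shows "eval s (height_expr a) = height n v"
  using assms by (cases v) (simp add: height_expr_def)

lemma eval_abscissa_expr:
  assumes "mem s 0 = n" "mem s (eval s a) = fst u" "mem s (eval s a + 1) = snd u"
    "mem s (eval s b) = fst v" "mem s (eval s b + 1) = snd v"
  shows "eval s (abscissa_expr a b) = abscissa n u v"
  using assms by (simp add: abscissa_expr_def eval_centre_expr abscissa_def)

lemma fits_centre_expr:
  assumes "mem s 0 = n" "mem s (eval s a) = fst v" "mem s (eval s a + 1) = snd v"
    "fits W s a" "fst v \<le> n" "snd v \<le> n" "eval s a + 1 \<le> W" "2 * n \<le> W"
  shows "fits W s (centre_expr a)"
  using assms by (cases v) (simp add: centre_expr_def)

text \<open>There are at most about \<open>2 * n\<close> levels, spaced \<open>n\<close> apart. This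
  quadratic size is the reason for the exponent 2 in the final word bound.\<close>

lemma height_le:
  assumes "fst v \<le> n" "snd v \<le> n"
  shows "(fst v + snd v) * n \<le> 2 * n\<^sup>2" "height n v \<le> n + 2 * n\<^sup>2"
proof -
  have "(fst v + snd v) * n \<le> (2 * n) * n"
    using assms by (intro mult_right_mono) simp_all
  then show "(fst v + snd v) * n \<le> 2 * n\<^sup>2" by (simp add: power2_eq_square)
  then show "height n v \<le> n + 2 * n\<^sup>2" using assms by (cases v) simp
qed

lemma fits_height_expr:
  assumes "mem s 0 = n" "mem s (eval s a) = fst v" "mem s (eval s a + 1) = snd v"
    "fits W s a" "fst v \<le> n" "snd v \<le> n" "eval s a + 1 \<le> W" "2 * n + 2 * n\<^sup>2 \<le> W"
  shows "fits W s (height_expr a)"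
  using assms height_le[OF assms(5,6)] by (cases v) (simp add: height_expr_def)

lemma centre_le: "snd v \<le> n \<Longrightarrow> centre n v \<le> 2 * n"
  by (cases v) simp

lemma fits_abscissa_expr:
  assumes "mem s 0 = n" "mem s (eval s a) = fst u" "mem s (eval s a + 1) = snd u"
    "mem s (eval s b) = fst v" "mem s (eval s b + 1) = snd v"
    "fits W s a" "fits W s b" "fst u \<le> n" "snd u \<le> n" "fst v \<le> n" "snd v \<le> n"
    "eval s a + 1 \<le> W" "eval s b + 1 \<le> W" "4 * n \<le> W" "1 \<le> W"
  shows "fits W s (abscissa_expr a b)"
  using assms centre_le[of u n] centre_le[of v n]
  by (simp add: abscissa_expr_def fits_centre_expr[of s n _ u] fits_centre_expr[of s n _ v]
      eval_centre_expr[of s n _ u] eval_centre_expr[of s n _ v]; intro conjI; linarith)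

text \<open>The rules of \<open>exec\<close> produce composite times and states; this turns
  agreement with the intended ones into separate equations.\<close>

lemma exec_cong: "exec W c s t s' \<Longrightarrow> t = t' \<Longrightarrow> s' = s'' \<Longrightarrow> exec W c s t' s''"
  by simp

text \<open>Expressions cannot read the tape, so values known before an \<open>Emit\<close> remain
  valid after it.\<close>

lemma eval_tape_update: "eval (s\<lparr>tape := xs\<rparr>) e = eval s e"
  by (induction e) simp_all

lemma fits_tape_update: "fits W (s\<lparr>tape := xs\<rparr>) e = fits W s e"
  by (induction e) (simp_all add: eval_tape_update)

text \<open>The cost is 15 for each bar end, 14 for the height and 4 for advancing the
  pointer.\<close>

lemma exec_vertex_code:
  assumes "mem s 0 = n" "regs s 0 = x" "mem s x = fst v" "mem s (x + 1) = snd v"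
    "fst v \<le> n" "snd v \<le> n" "x + 2 \<le> W" "4 * n + 2 * n\<^sup>2 + 2 \<le> W"
  shows "exec W vertex_code s 48
    (s\<lparr>regs := (regs s)(0 := x + 2),
       tape := tape s @ [2 * centre n v - 2, 2 * centre n v + 2, height n v]\<rparr>)"
proof -
  let ?c = "centre_expr (Reg 0)" and ?h = "height_expr (Reg 0)"
  have ev: "eval s ?c = centre n v" "eval s ?h = height n v"
    using assms by (simp_all add: eval_centre_expr eval_height_expr)
  have ft: "fits W s ?c" "fits W s ?h"
    using assms by (simp_all add: fits_centre_expr[of s n _ v] fits_height_expr[of s n _ v])
  have cost: "expr_cost ?c = 10" "expr_cost ?h = 13"
    by (simp_all add: centre_expr_def height_expr_def)
  have "2 * centre n v + 2 \<le> W"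
    using assms centre_le[of v n] by simp
  then show ?thesis
    unfolding vertex_code_def
    by (intro exec_cong[OF exec.Seq[OF exec.Emit exec.Seq[OF exec.Emit
              exec.Seq[OF exec.Emit exec.Assign]]]])
      (use assms ev ft cost in \<open>simp_all add: eval_tape_update fits_tape_update\<close>)
qed

text \<open>The cost is 7 and 9 for the two addresses, 68 for the abscissa, 14 for each height and 4
  for advancing the pointer.\<close>

lemma exec_edge_code:
  assumes "mem s 0 = n" "regs s 0 = x" "mem s x = a" "mem s (x + 1) = b"
    "mem s (2 + 2 * a) = fst u" "mem s (2 + 2 * a + 1) = snd u"
    "mem s (2 + 2 * b) = fst v" "mem s (2 + 2 * b + 1) = snd v"
    "fst u \<le> n" "snd u \<le> n" "fst v \<le> n" "snd v \<le> n" "a < n" "b < n"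
    "x + 2 \<le> W" "4 * n + 2 * n\<^sup>2 + 2 \<le> W"
  shows "exec W edge_code s 116
    (s\<lparr>regs := (regs s)(2 := 2 + 2 * a, 3 := 2 + 2 * b, 0 := x + 2),
       tape := tape s @ [abscissa n u v, height n u, height n v]\<rparr>)"
proof -
  let ?x = "abscissa_expr (Reg 2) (Reg 3)"
  let ?h = "height_expr (Reg 2)" and ?h' = "height_expr (Reg 3)"
  define s1 where "s1 = s\<lparr>regs := (regs s)(2 := 2 + 2 * a)\<rparr>"
  define s2 where "s2 = s\<lparr>regs := (regs s)(2 := 2 + 2 * a, 3 := 2 + 2 * b)\<rparr>"
  have ev: "eval s2 ?x = abscissa n u v" "eval s2 ?h = height n u" "eval s2 ?h' = height n v"
    using assms by (simp_all add: s2_def eval_abscissa_expr eval_height_expr)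
  have "2 + 2 * a + 1 \<le> W" "2 + 2 * b + 1 \<le> W"
    using assms by linarith+
  then have ft: "fits W s2 ?x" "fits W s2 ?h" "fits W s2 ?h'"
    using assms
    by (simp_all add: s2_def fits_abscissa_expr[of _ n _ u _ v] fits_height_expr[of _ n _ u]
        fits_height_expr[of _ n _ v])
  have cost: "expr_cost ?x = 67" "expr_cost ?h = 13" "expr_cost ?h' = 13"
    by (simp_all add: abscissa_expr_def centre_expr_def height_expr_def)
  have 1: "exec W (Assign 2 (Plus (Const 2) (Times (Const 2) (Load (Reg 0))))) s 7 s1"
    by (rule exec_cong[OF exec.Assign]) (use assms in \<open>simp_all add: s1_def\<close>)
  have 2: "exec W (Assign 3 (Plus (Const 2) (Times (Const 2) (Load (Plus (Reg 0) (Const 1)))))) s1 9 s2"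
    by (rule exec_cong[OF exec.Assign]) (use assms in \<open>simp_all add: s1_def s2_def\<close>)
  show ?thesis
    unfolding edge_code_def
    by (rule exec_cong[OF exec.Seq[OF 1 exec.Seq[OF 2 exec.Seq[OF exec.Emit exec.Seq[OF exec.Emit
              exec.Seq[OF exec.Emit exec.Assign]]]]]])
      (use assms ev ft cost in \<open>simp_all add: eval_tape_update fits_tape_update\<close>,
        use assms in \<open>simp_all add: s2_def\<close>)
qed

section \<open>Memory layout of the input and the complete run\<close>

lemma length_concat_pairs: "length (concat (map (\<lambda>(i, j). [i, j]) xs)) = 2 * length xs"
  by (induction xs) auto

lemma nth_concat_pairs:
  assumes "k < length xs"
  shows "concat (map (\<lambda>(i, j). [i, j]) xs) ! (2 * k) = fst (xs ! k)"
    and "concat (map (\<lambda>(i, j). [i, j]) xs) ! (2 * k + 1) = snd (xs ! k)"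
  using assms
proof (induction xs arbitrary: k)
  case (Cons x xs)
  { case 1 then show ?case using Cons.IH(1) by (cases k; cases x) auto }
  { case 2 then show ?case using Cons.IH(2) by (cases k; cases x) auto }
qed simp_all

lemma mem_initial_state_input_word:
  fixes vs es
  defines "M \<equiv> mem (initial_state (input_word vs es))"
  shows "M 0 = length vs" "M 1 = length es"
    and "k < length vs \<Longrightarrow> M (2 + 2 * k) = fst (vs ! k)"
    and "k < length vs \<Longrightarrow> M (2 + 2 * k + 1) = snd (vs ! k)"
    and "k < length es \<Longrightarrow> M (2 + 2 * length vs + 2 * k) = fst (es ! k)"
    and "k < length es \<Longrightarrow> M (2 + 2 * length vs + 2 * k + 1) = snd (es ! k)"
  using nth_concat_pairs[of k vs] nth_concat_pairs[of k es]
  by (simp_all add: M_def initial_state_def input_word_def length_concat_pairs nth_append)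

text \<open>A round costs \<open>48 + 4\<close> per vertex and \<open>116 + 4\<close> per edge; the
  24 are the three assignments (2, 7, 7) and the two loop exits. The bound on \<open>W\<close>
  covers the addresses, linear in \<open>n\<close> and \<open>m\<close>, as well as the quadratic
  heights.\<close>

lemma exec_drawing_code:
  fixes vs es W
  defines "n \<equiv> length vs" and "m \<equiv> length es"
  assumes vs: "\<And>v. v \<in> set vs \<Longrightarrow> fst v \<le> n \<and> snd v \<le> n"
    and es: "\<And>a b. (a, b) \<in> set es \<Longrightarrow> a < n \<and> b < n"
    and W: "6 * n + 2 * n\<^sup>2 + 2 * m + 2 \<le> W"
  shows "runs W drawing_code (input_word vs es) (24 + 52 * n + 120 * m)
    (concat (map (\<lambda>k. [2 * centre n (vs ! k) - 2, 2 * centre n (vs ! k) + 2, height n (vs ! k)]) [0..<n]) @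
     concat (map (\<lambda>k. case es ! k of (a, b) \<Rightarrow>
       [abscissa n (vs ! a) (vs ! b), height n (vs ! a), height n (vs ! b)]) [0..<m]))"
proof -
  define s0 where "s0 = initial_state (input_word vs es)"
  define M where "M = mem s0"
  note M = mem_initial_state_input_word[where vs = vs and es = es, folded n_def m_def s0_def, folded M_def]
  define s1 where "s1 = s0\<lparr>regs := (regs s0)(0 := 2)\<rparr>"
  define s2 where "s2 = s0\<lparr>regs := (regs s0)(0 := 2, 1 := 2 + 2 * n)\<rparr>"
  have 1: "exec W (Assign 0 (Const 2)) s0 2 s1"
    by (rule exec_cong[OF exec.Assign]) (use W in \<open>simp_all add: s1_def\<close>)
  have 2: "exec W (Assign 1 (Plus (Reg 0) (Times (Const 2) (Load (Const 0))))) s1 7 s2"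
    by (rule exec_cong[OF exec.Assign])
      (use W M(1) in \<open>simp_all add: s1_def s2_def flip: M_def\<close>)
  have "\<exists>s3. exec W (While (Minus (Reg 1) (Reg 0)) vertex_code) s2 ((n - 0) * (48 + 4) + 4) s3 \<and>
      mem s3 = M \<and> regs s3 0 = 2 + 2 * n \<and> tape s3 = tape s2 @
      concat (map (\<lambda>k. [2 * centre n (vs ! k) - 2, 2 * centre n (vs ! k) + 2, height n (vs ! k)]) [0..<n])"
  proof (rule exec_scan)
    fix k and s :: state
    assume k: "k < n" and s: "mem s = M" "regs s 0 = 2 + 2 * k" "regs s 1 = 2 + 2 * n"
    have "exec W vertex_code s 48 (s\<lparr>regs := (regs s)(0 := 2 + 2 * k + 2),
       tape := tape s @ [2 * centre n (vs ! k) - 2, 2 * centre n (vs ! k) + 2, height n (vs ! k)]\<rparr>)"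
      using M(3,4)[OF k] k vs[of "vs ! k"] W by (intro exec_vertex_code) (simp_all add: s M(1) n_def)
    then show "\<exists>s'. exec W vertex_code s 48 s' \<and> mem s' = M \<and> regs s' 0 = 2 + 2 * (k + 1) \<and>
      regs s' 1 = 2 + 2 * n \<and> tape s' =
      tape s @ [2 * centre n (vs ! k) - 2, 2 * centre n (vs ! k) + 2, height n (vs ! k)]"
      using s by (intro exI conjI) (assumption, simp_all)
  qed (use W in \<open>simp_all add: s2_def M_def\<close>)
  then obtain s3 where 3: "exec W (While (Minus (Reg 1) (Reg 0)) vertex_code) s2 (n * 52 + 4) s3"
    and s3: "mem s3 = M" "regs s3 0 = 2 + 2 * n" "tape s3 = tape s2 @
      concat (map (\<lambda>k. [2 * centre n (vs ! k) - 2, 2 * centre n (vs ! k) + 2, height n (vs ! k)]) [0..<n])"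
    by auto
  define s4 where "s4 = s3\<lparr>regs := (regs s3)(1 := 2 + 2 * n + 2 * m)\<rparr>"
  have 4: "exec W (Assign 1 (Plus (Reg 0) (Times (Const 2) (Load (Const 1))))) s3 7 s4"
    by (rule exec_cong[OF exec.Assign]) (use W M(2) s3 in \<open>simp_all add: s4_def\<close>)
  \<comment> \<open>The second scan starts at \<open>2 + 2 * n\<close>, where the first one
    stopped.\<close>
  have "\<exists>s5. exec W (While (Minus (Reg 1) (Reg 0)) edge_code) s4 ((m - 0) * (116 + 4) + 4) s5 \<and>
      mem s5 = M \<and> regs s5 0 = (2 + 2 * n) + 2 * m \<and> tape s5 = tape s4 @
      concat (map (\<lambda>k. case es ! k of (a, b) \<Rightarrow>
       [abscissa n (vs ! a) (vs ! b), height n (vs ! a), height n (vs ! b)]) [0..<m])"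
  proof (rule exec_scan)
    fix k and s :: state
    assume k: "k < m" and s: "mem s = M" "regs s 0 = (2 + 2 * n) + 2 * k" "regs s 1 = (2 + 2 * n) + 2 * m"
    obtain a b where ab: "es ! k = (a, b)" by (cases "es ! k")
    then have less: "a < n" "b < n" using es[of a b] k nth_mem[of k es] by (simp_all add: m_def)
    have "exec W edge_code s 116
      (s\<lparr>regs := (regs s)(2 := 2 + 2 * a, 3 := 2 + 2 * b, 0 := 2 + 2 * n + 2 * k + 2),
       tape := tape s @ [abscissa n (vs ! a) (vs ! b), height n (vs ! a), height n (vs ! b)]\<rparr>)"
    proof (rule exec_edge_code)
      show "mem s (2 + 2 * n + 2 * k) = a" "mem s (2 + 2 * n + 2 * k + 1) = b"
        using M(5,6)[OF k] ab s(1) by simp_all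
      show "mem s (2 + 2 * a) = fst (vs ! a)" "mem s (2 + 2 * a + 1) = snd (vs ! a)"
        "mem s (2 + 2 * b) = fst (vs ! b)" "mem s (2 + 2 * b + 1) = snd (vs ! b)"
        using M(3,4) less s(1) by simp_all
      show "fst (vs ! a) \<le> n" "snd (vs ! a) \<le> n" "fst (vs ! b) \<le> n" "snd (vs ! b) \<le> n"
        using less vs[of "vs ! a"] vs[of "vs ! b"] by (simp_all add: n_def)
    qed (use s k M(1) less W in simp_all)
    then show "\<exists>s'. exec W edge_code s 116 s' \<and> mem s' = M \<and>
      regs s' 0 = (2 + 2 * n) + 2 * (k + 1) \<and> regs s' 1 = (2 + 2 * n) + 2 * m \<and>
      tape s' = tape s @ (case es ! k of (a, b) \<Rightarrow>
       [abscissa n (vs ! a) (vs ! b), height n (vs ! a), height n (vs ! b)])"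
      using s ab by (intro exI conjI) (assumption, simp_all)
  qed (use W s3 in \<open>simp_all add: s4_def\<close>)
  then obtain s5 where 5: "exec W (While (Minus (Reg 1) (Reg 0)) edge_code) s4 (m * 120 + 4) s5"
    and s5: "tape s5 = tape s4 @ concat (map (\<lambda>k. case es ! k of (a, b) \<Rightarrow>
       [abscissa n (vs ! a) (vs ! b), height n (vs ! a), height n (vs ! b)]) [0..<m])"
    by auto
  have "exec W drawing_code s0 (24 + 52 * n + 120 * m) s5"
    unfolding drawing_code_def
    by (rule exec_cong[OF exec.Seq[OF 1 exec.Seq[OF 2 exec.Seq[OF 3 exec.Seq[OF 4 5]]]]]) simp_all
  moreover have "tape s2 = []"
    by (simp add: s2_def s0_def initial_state_def)
  ultimately show ?thesis
    unfolding runs_def s0_def[symmetric] using s5 s3(3) by (intro exI conjI) (assumption, simp add: s4_def)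
qed

section \<open>Correctness of the output and the final bounds\<close>

lemma output_describes_drawing:
  fixes vs es
  defines "n \<equiv> length vs"
  shows "output_describes
    (concat (map (\<lambda>k. [2 * centre n (vs ! k) - 2, 2 * centre n (vs ! k) + 2, height n (vs ! k)]) [0..<length vs]) @
     concat (map (\<lambda>k. case es ! k of (a, b) \<Rightarrow>
       [abscissa n (vs ! a) (vs ! b), height n (vs ! a), height n (vs ! b)]) [0..<length es]))
    vs es (bar n) (edge_segment n)"
proof -
  define bs where "bs = map (\<lambda>k. (2 * centre n (vs ! k) - 2, 2 * centre n (vs ! k) + 2,
    height n (vs ! k))) [0..<length vs]"
  define ss where "ss = map (\<lambda>k. case es ! k of (a, b) \<Rightarrow>
    (abscissa n (vs ! a) (vs ! b), height n (vs ! a), height n (vs ! b))) [0..<length es]"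
  show ?thesis
    unfolding output_describes_def
    by (intro exI[of _ bs] exI[of _ ss] conjI)
      (auto simp: bs_def ss_def comp_def bar_def edge_segment_doubleton joint_def split_beta
        simp del: centre.simps height.simps)
qed

theorem theorem1:
  "(\<exists>(prog :: com) (c :: nat) (d :: nat). \<forall>(p :: nat) (q :: nat) vs es.
      1 \<le> p \<longrightarrow> 1 \<le> q \<longrightarrow> represents vs es (diagonal_grid_graph p q) \<longrightarrow>
      (\<exists>t ys.
         runs (c * card (verts (diagonal_grid_graph p q)) ^ d) prog (input_word vs es) t ys \<and>
         t \<le> c * card (verts (diagonal_grid_graph p q)) \<and>
         (\<exists>B S. output_describes ys vs es B S \<and>
                bar_1_visibility_drawing (diagonal_grid_graph p q) B S))) \<and>
   (\<forall>(p :: nat) (q :: nat). 1 \<le> p \<longrightarrow> 1 \<le> q \<longrightarrow> bar_1_visible (diagonal_grid_graph p q))"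
proof (rule conjI)
  show "\<forall>(p :: nat) (q :: nat). 1 \<le> p \<longrightarrow> 1 \<le> q \<longrightarrow> bar_1_visible (diagonal_grid_graph p q)"
    unfolding bar_1_visible_def using drawing_diagonal_grid by blast
next
  \<comment> \<open>With \<open>m \<le> 4 * n\<close> the running time is at most
    \<open>24 + 532 * n\<close>, and \<open>n \<ge> 1\<close> gives \<open>556 * n\<close>.\<close>
  have "\<exists>t ys.
         runs (556 * card (verts (diagonal_grid_graph p q)) ^ 2) drawing_code (input_word vs es) t ys \<and>
         t \<le> 556 * card (verts (diagonal_grid_graph p q)) \<and>
         (\<exists>B S. output_describes ys vs es B S \<and>
                bar_1_visibility_drawing (diagonal_grid_graph p q) B S)"
    if pq: "1 \<le> p" "1 \<le> q" and rep: "represents vs es (diagonal_grid_graph p q)" for p q vs es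
  proof -
    define n where "n = length vs"
    define m where "m = length es"
    have V: "set vs = {1..p} \<times> {1..q}" "card (verts (diagonal_grid_graph p q)) = n"
      using rep distinct_card[of vs]
      by (simp_all add: represents_def diagonal_grid_graph_def grid_verts_def n_def)
    \<comment> \<open>The drawing only asks for a parameter that is at least \<open>p\<close>. The
      number of vertices qualifies and can be read from cell 0, so \<open>p\<close> need not be
      recovered from the unordered input.\<close>
    then have n: "n = p * q"
      by (simp add: diagonal_grid_graph_def grid_verts_def)
    then have le: "p \<le> n" "q \<le> n" "1 \<le> n"
      using pq by simp_all
    have "m = card (edges (diagonal_grid_graph p q))"
      using rep distinct_card[of "map (\<lambda>(a, b). {vs ! a, vs ! b}) es"]
      by (simp add: represents_def m_def)
    then have m: "m \<le> 4 * n"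
      using card_edges_diagonal_grid_le[of p q] V(2) by simp
    have "n \<le> n\<^sup>2"
      using le(3) by (simp add: power2_eq_square)
    then have W: "6 * n + 2 * n\<^sup>2 + 2 * m + 2 \<le> 556 * n\<^sup>2"
      using m le(3) by linarith
    have es: "a < n \<and> b < n" if "(a, b) \<in> set es" for a b
      using rep that by (auto simp: represents_def n_def)
    have vs: "fst v \<le> n \<and> snd v \<le> n" if "v \<in> set vs" for v
      using that V(1) le by auto
    show ?thesis
      unfolding V(2)
      using exec_drawing_code[of vs es "556 * n\<^sup>2", folded n_def m_def, OF vs es W]
        output_describes_drawing[of vs es, folded n_def m_def]
        drawing_diagonal_grid[OF le(1), of q] m le(3)
      by (intro exI conjI) (assumption | linarith)+
  qed
  then show "\<exists>(prog :: com) (c :: nat) (d :: nat). \<forall>(p :: nat) (q :: nat) vs es.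
      1 \<le> p \<longrightarrow> 1 \<le> q \<longrightarrow> represents vs es (diagonal_grid_graph p q) \<longrightarrow>
      (\<exists>t ys.
         runs (c * card (verts (diagonal_grid_graph p q)) ^ d) prog (input_word vs es) t ys \<and>
         t \<le> c * card (verts (diagonal_grid_graph p q)) \<and>
         (\<exists>B S. output_describes ys vs es B S \<and>
                bar_1_visibility_drawing (diagonal_grid_graph p q) B S))"
    by blast
qed

end
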